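(* Every class of graphs of bounded expansion has bounded merge-width.
   Context: Graphs are finite, simple and undirected: $G=(V,E(G))$ with $E(G)\subseteq\binom V2$. Bounded expansion. A graph class $\mathcal C$ has bounded expansion if for every $r\in\mathbb N$ there is $k\in\mathbb R$ such that for every graph $H$ which can be obtained from some graph in $\mathcal C$ by first removing vertices and edges, and then contracting some pairwise disjoint vertex subsets inducing connected subgraphs of radius at most $r$ to single vertices, we have $|E(H)|\le k\cdot|V(H)|$. Merge-width. A construction sequence on $V$ is a sequence of steps maintaining a partition $\mathcal P$ of $V$ and a partition of $\binom V2$ into edges $E$, non-edges $N$, and unresolved pairs $U$. Initially $\mathcal P$ is the partition into singletons and $U=\binom V2$. In each step one of three operations is performed: merge two parts $A,B\in\mathcal P$, replacing them by $A\cup B$; resolve positively a pair of parts $A,B\in\mathcal P$ (possibly $A=B$), moving all $\{a,b\}\in U$ with $a\in A,b\in B$ from $U$ to $E$; or resolve negatively such a pair of parts, moving these pairs from $U$ to $N$. In the end $\mathcal P$ has one part and $U=\emptyset$; it is then a construction sequence of the graph $(V,E)$. Its radius-$r$ width is the least $k$ such that at every step, for every $v\in V$, at most $k$ parts of the current $\mathcal P$ contain a vertex reachable from $v$ by a path of length at most $r$ in the graph $(V,E\cup N)$ for the current $E,N$. The radius-$r$ merge-width $\mathrm{mw}_r(G)$ is the least radius-$r$ width of a construction sequence of $G$. A graph class $\mathcal C$ has bounded merge-width if $\sup_{G\in\mathcal C}\mathrm{mw}_r(G)<\infty$ for every $r\in\mathbb N$. *)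

theory Defs
  imports
    Complex_Main
    "HOL-Library.Extended_Nat"
    "HOL-Library.Disjoint_Sets"
    "HOL-Library.Ramsey"
begin

section \<open>Graphs\<close>

datatype 'a graph = Graph (verts: "'a set") (edges: "'a set set")

definition fin_simple_graph :: "'a graph \<Rightarrow> bool" where
  "fin_simple_graph G \<longleftrightarrow> finite (verts G) \<and> edges G \<subseteq> nsets (verts G) 2"

definition graph_class :: "'a graph set \<Rightarrow> bool" where
  "graph_class \<C> \<longleftrightarrow> (\<forall>G\<in>\<C>. fin_simple_graph G)"

text \<open>A path is given by its list of vertices; its length is the number of edges.\<close>

definition is_path :: "'a graph \<Rightarrow> 'a \<Rightarrow> 'a list \<Rightarrow> 'a \<Rightarrow> bool" where
  "is_path G u p v \<longleftrightarrow>
     p \<noteq> [] \<and> hd p = u \<and> last p = v \<and> set p \<subseteq> verts G \<and> distinct p \<and>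
     successively (\<lambda>x y. {x, y} \<in> edges G) p"

definition path_length :: "'a list \<Rightarrow> nat" where
  "path_length p = length p - 1"

definition graph_dist :: "'a graph \<Rightarrow> 'a \<Rightarrow> 'a \<Rightarrow> enat" where
  "graph_dist G u v = (INF p\<in>{p. is_path G u p v}. enat (path_length p))"

definition connected_graph :: "'a graph \<Rightarrow> bool" where
  "connected_graph G \<longleftrightarrow>
     verts G \<noteq> {} \<and> (\<forall>u\<in>verts G. \<forall>v\<in>verts G. \<exists>p. is_path G u p v)"

definition radius :: "'a graph \<Rightarrow> enat" where
  "radius G = (INF c\<in>verts G. SUP v\<in>verts G. graph_dist G c v)"

definition subgraph :: "'a graph \<Rightarrow> 'a graph \<Rightarrow> bool" where
  "subgraph G' G \<longleftrightarrow>
     verts G' \<subseteq> verts G \<and> edges G' \<subseteq> edges G \<and> edges G' \<subseteq> nsets (verts G') 2"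

definition induced_subgraph :: "'a graph \<Rightarrow> 'a set \<Rightarrow> 'a graph" where
  "induced_subgraph G X = Graph X {e \<in> edges G. e \<subseteq> X}"


section \<open>Bounded expansion\<close>

text \<open>The vertices of the contracted graph are sets of vertices of \<open>G\<close>: the contracted sets
  \<open>X \<in> \<S>\<close>, and \<open>{v}\<close> for every vertex \<open>v\<close> that belongs to no contracted set. Loops and parallel
  edges arising from the contraction are dropped.\<close>

definition contract :: "'a graph \<Rightarrow> 'a set set \<Rightarrow> 'a set graph" where
  "contract G \<S> =
     (let W = \<S> \<union> {{v} | v. v \<in> verts G - \<Union>\<S>}
      in Graph W {{X, Y} | X Y. X \<in> W \<and> Y \<in> W \<and> X \<noteq> Y \<and> (\<exists>x\<in>X. \<exists>y\<in>Y. {x, y} \<in> edges G)})"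

definition shallow_minor :: "nat \<Rightarrow> 'a set graph \<Rightarrow> 'a graph \<Rightarrow> bool" where
  "shallow_minor r H G \<longleftrightarrow>
     (\<exists>G' \<S>. subgraph G' G \<and> disjoint \<S> \<and>
        (\<forall>X\<in>\<S>. X \<subseteq> verts G' \<and> connected_graph (induced_subgraph G' X) \<and>
                radius (induced_subgraph G' X) \<le> enat r) \<and>
        H = contract G' \<S>)"

definition bounded_expansion :: "'a graph set \<Rightarrow> bool" where
  "bounded_expansion \<C> \<longleftrightarrow>
     (\<forall>r::nat. \<exists>k::real. \<forall>G\<in>\<C>. \<forall>H. shallow_minor r H G \<longrightarrow>
        real (card (edges H)) \<le> k * real (card (verts H)))"


section \<open>Merge-width\<close>

datatype 'a config =
  Config (parts: "'a set set") (pos: "'a set set") (neg: "'a set set") (unresolved: "'a set set")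

definition initial_config :: "'a set \<Rightarrow> 'a config" where
  "initial_config V = Config {{v} | v. v \<in> V} {} {} (nsets V 2)"

definition pairs_between :: "'a set \<Rightarrow> 'a set \<Rightarrow> 'a set set" where
  "pairs_between A B = {{a, b} | a b. a \<in> A \<and> b \<in> B}"

inductive construction_step :: "'a config \<Rightarrow> 'a config \<Rightarrow> bool" where
  merge: "A \<in> P \<Longrightarrow> B \<in> P \<Longrightarrow> A \<noteq> B \<Longrightarrow>
    construction_step (Config P E N U) (Config (insert (A \<union> B) (P - {A, B})) E N U)"
| resolve_pos: "A \<in> P \<Longrightarrow> B \<in> P \<Longrightarrow>
    construction_step (Config P E N U)
      (Config P (E \<union> (U \<inter> pairs_between A B)) N (U - pairs_between A B))"
| resolve_neg: "A \<in> P \<Longrightarrow> B \<in> P \<Longrightarrow>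
    construction_step (Config P E N U)
      (Config P E (N \<union> (U \<inter> pairs_between A B)) (U - pairs_between A B))"

text \<open>A construction sequence is represented by the list of all its configurations, from the initial
  to the final one. In the final configuration there is one part; we write \<open>\<le> 1\<close> so that the graph
  without vertices, whose only partition has no part, has a construction sequence as well.\<close>

definition construction_sequence :: "'a graph \<Rightarrow> 'a config list \<Rightarrow> bool" where
  "construction_sequence G cs \<longleftrightarrow>
     cs \<noteq> [] \<and> hd cs = initial_config (verts G) \<and> successively construction_step cs \<and>
     card (parts (last cs)) \<le> 1 \<and> unresolved (last cs) = {} \<and> pos (last cs) = edges G"

definition reachable_parts :: "nat \<Rightarrow> 'a set \<Rightarrow> 'a config \<Rightarrow> 'a \<Rightarrow> 'a set set" where
  "reachable_parts r V c v =
     {A \<in> parts c. \<exists>u\<in>A. \<exists>p. is_path (Graph V (pos c \<union> neg c)) v p u \<and> path_length p \<le> r}"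

definition sequence_width :: "nat \<Rightarrow> 'a set \<Rightarrow> 'a config list \<Rightarrow> nat" where
  "sequence_width r V cs =
     (LEAST k. \<forall>c\<in>set cs. \<forall>v\<in>V. card (reachable_parts r V c v) \<le> k)"

definition merge_width :: "nat \<Rightarrow> 'a graph \<Rightarrow> enat" where
  "merge_width r G =
     (INF cs\<in>{cs. construction_sequence G cs}. enat (sequence_width r (verts G) cs))"

definition bounded_merge_width :: "'a graph set \<Rightarrow> bool" where
  "bounded_merge_width \<C> \<longleftrightarrow> (\<forall>r::nat. (SUP G\<in>\<C>. merge_width r G) < \<infinity>)"

end

theory Submission
  imports Defs
begin

text \<open>Fix a radius \<open>r\<close> and a graph \<open>G\<close> of the class. The construction sequence has one stage for every
  set \<open>L\<close> in a chain from all vertices down to the empty set. At stage \<open>L\<close> the vertices in \<open>L\<close> are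
  singleton parts, the other vertices are grouped by their neighbourhood in \<open>L\<close>, the edges avoiding
  \<open>L\<close> are resolved positively, and nothing is resolved negatively. Moving a vertex \<open>v\<close> out of \<open>L\<close> is
  possible because every part is homogeneous towards \<open>v\<close>: the edges at \<open>v\<close> are resolved part by part,
  and then parts that differed only in their adjacency to \<open>v\<close> are merged. At \<open>L = {}\<close> all edges are
  resolved and one part is left, so a single negative resolution finishes.

  The parts that a vertex reaches are counted by the neighbourhoods in \<open>L\<close> of the vertices reached,
  and these are subsets of the boundary: the vertices of \<open>L\<close> adjacent to something reachable in
  \<open>r\<close> steps outside \<open>L\<close>. The width is thus bounded once boundaries are. For this it suffices that every
  vertex outside \<open>L\<close> is separated from \<open>L\<close>, with respect to walks of length at most \<open>r + 1\<close>, by \<open>K\<close>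
  vertices: following a walk from one separator vertex to the next gives boundaries of size at most
  \<open>K ^ (r + 1)\<close> (\<open>card_boundary_le\<close>).

  The next vertex to leave \<open>L\<close> only has to be separated in this sense from the rest of \<open>L\<close>. Such a
  vertex exists for every \<open>L\<close> (\<open>exists_separated_vertex\<close>); in other words, generalised colouring
  numbers are bounded. If there were none, then a shallow minor that is as dense as possible on
  the branch vertices \<open>L\<close> would uncover, around a large independent set of branch vertices, the stars of
  a second shallow minor that has too many edges. The argument uses only one consequence of bounded
  expansion, the linear edge bound \<open>sparse_minors\<close> for families of disjoint clusters of bounded
  radius.\<close>

section \<open>Bounded reachability\<close>

text \<open>The end points of walks of length at most \<open>n\<close> from \<open>u\<close> all of whose later vertices lie in \<open>X\<close>.
  The start need not lie in \<open>X\<close>: typically it belongs to a set that the walk must avoid afterwards.\<close>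

primrec reach :: "'a set set \<Rightarrow> 'a set \<Rightarrow> nat \<Rightarrow> 'a \<Rightarrow> 'a set" where
  "reach E X 0 u = {u}"
| "reach E X (Suc n) u = reach E X n u \<union> {y \<in> X. \<exists>x\<in>reach E X n u. {x, y} \<in> E}"

lemma reach_self: "u \<in> reach E X n u"
  by (induction n) auto

lemma reach_subset: "reach E X n u \<subseteq> insert u X"
  by (induction n) auto

lemma reach_step: "x \<in> reach E X n u \<Longrightarrow> {x, y} \<in> E \<Longrightarrow> y \<in> X \<Longrightarrow> y \<in> reach E X (Suc n) u"
  by auto

lemma reach_mono:
  assumes "E \<subseteq> E'" "X \<subseteq> X'" "n \<le> n'"
  shows "reach E X n u \<subseteq> reach E' X' n' u"
proof -
  have "reach E X n u \<subseteq> reach E' X' n u"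
    using assms(1,2) by (induction n) auto
  moreover have "reach E' X' n u \<subseteq> reach E' X' n' u"
    using assms(3) by (rule lift_Suc_mono_le[rotated]) auto
  ultimately show ?thesis by blast
qed

lemma reach_trans:
  assumes "x \<in> reach E X n u" "y \<in> reach E X m x"
  shows "y \<in> reach E X (n + m) u"
  using assms(2)
proof (induction m arbitrary: y)
  case 0
  then show ?case using assms(1) by simp
next
  case (Suc m)
  then show ?case by auto
qed

lemma reach_step_first:
  assumes "{u, v} \<in> E" "v \<in> X" "x \<in> reach E X n v"
  shows "x \<in> reach E X (Suc n) u"
  using reach_trans[of v E X 1 u x n] assms by auto

lemma reach_sym:
  assumes "u \<in> X" "v \<in> reach E X n u"
  shows "u \<in> reach E X n v"
  using assms(2)
proof (induction n arbitrary: v)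
  case 0
  then show ?case by simp
next
  case (Suc n)
  show ?case
  proof (cases "v \<in> reach E X n u")
    case True
    then show ?thesis using Suc.IH by simp
  next
    case False
    then obtain x where x: "x \<in> reach E X n u" "{v, x} \<in> E"
      using Suc.prems by (auto simp: insert_commute)
    then have "x \<in> X" using reach_subset assms(1) by fastforce
    then show ?thesis using reach_step_first[OF x(2)] Suc.IH[OF x(1)] by blast
  qed
qed

lemma reach_within_reach: "reach E X n u \<subseteq> reach E (reach E X n u) n u"
proof -
  have "reach E X m u \<subseteq> reach E (reach E X n u) m u" if "m \<le> n" for m
    using that
  proof (induction m)
    case 0
    then show ?case by simp
  next
    case (Suc m)
    have "reach E X (Suc m) u \<subseteq> reach E X n u"
      using reach_mono[of E E X X "Suc m" n] Suc.prems by blast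
    then show ?case using Suc by auto
  qed
  then show ?thesis by blast
qed

text \<open>Consider the first moment at which a walk enters \<open>T\<close>: the rest of the walk is strictly shorter.
  This drives the recursion that bounds boundaries.\<close>

lemma reach_split:
  assumes "x \<in> reach E X n u"
  shows "x \<in> reach E (X - T) n u \<or> (\<exists>s\<in>T \<inter> X. \<exists>m<n. x \<in> reach E X m s)"
  using assms
proof (induction n arbitrary: x)
  case 0
  then show ?case by simp
next
  case (Suc n)
  show ?case
  proof (cases "x \<in> reach E X n u")
    case True
    then show ?thesis using Suc.IH[OF True] less_SucI unfolding reach.simps(2) by blast
  next
    case False
    then obtain y where y: "y \<in> reach E X n u" "{y, x} \<in> E" "x \<in> X"
      using Suc.prems by auto
    from Suc.IH[OF y(1)] show ?thesis
    proof
      assume "y \<in> reach E (X - T) n u"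
      moreover have "x \<in> reach E X 0 x" by simp
      ultimately show ?thesis using y(2,3)
        by (metis DiffI IntI reach_step zero_less_Suc)
    next
      assume "\<exists>s\<in>T \<inter> X. \<exists>m<n. y \<in> reach E X m s"
      then show ?thesis using y(2,3) reach_step by (metis Suc_less_eq)
    qed
  qed
qed

text \<open>Two walks with a common end form a walk from \<open>u\<close> to \<open>v\<close>. As \<open>v\<close> lies outside \<open>X\<close>, the
  conclusion speaks of its last vertex before \<open>v\<close>.\<close>

lemma reach_meet:
  assumes "v \<notin> X" "v \<noteq> u" "y \<in> reach E X m v" "y \<in> reach E X n u"
  shows "\<exists>z\<in>reach E X (n + m) u. {z, v} \<in> E"
  using assms(3,4)
proof (induction m arbitrary: y n)
  case 0
  then show ?case using reach_subset[of E X n u] assms(1,2) by auto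
next
  case (Suc m)
  show ?case
  proof (cases "y \<in> reach E X m v")
    case True
    from Suc.IH[OF True Suc.prems(2)] show ?thesis
      by auto
  next
    case False
    then obtain y' where y': "y' \<in> reach E X m v" "{y', y} \<in> E" "y \<in> X"
      using Suc.prems(1) by auto
    show ?thesis
    proof (cases "y' = v")
      case True
      then have "{y, v} \<in> E" using y'(2) by (simp add: insert_commute)
      moreover have "y \<in> reach E X (n + Suc m) u"
        using Suc.prems(2) reach_mono[of E E X X n "n + Suc m" u] by auto
      ultimately show ?thesis by blast
    next
      case False
      then have "y' \<in> X" using y'(1) reach_subset by fastforce
      then have "y' \<in> reach E X (Suc n) u"
        using Suc.prems(2) y'(2) reach_step by (metis insert_commute)
      from Suc.IH[OF y'(1) this] show ?thesis by simp
    qed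
  qed
qed

text \<open>\<open>Q\<close> is the vertex set of a walk from \<open>u\<close> to \<open>x\<close>, without its start. A cluster at \<open>u\<close> can absorb
  it at the price of \<open>n\<close> vertices and keeps its radius if that is at least \<open>n\<close>.\<close>

lemma reach_small_witness:
  assumes "x \<in> reach E X n u"
  obtains Q where "Q \<subseteq> X" "finite Q" "card Q \<le> n" "Q \<subseteq> reach E Q n u" "x \<in> insert u Q"
proof -
  have "\<exists>Q\<subseteq>X. finite Q \<and> card Q \<le> n \<and> Q \<subseteq> reach E Q n u \<and> x \<in> insert u Q"
    using assms
  proof (induction n arbitrary: x)
    case 0
    then show ?case by (intro exI[of _ "{}"]) auto
  next
    case (Suc n)
    show ?case
    proof (cases "x \<in> reach E X n u")
      case True
      from Suc.IH[OF True] show ?thesis by (auto intro: le_SucI)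
    next
      case False
      then obtain y where y: "y \<in> reach E X n u" "{y, x} \<in> E" "x \<in> X"
        using Suc.prems by auto
      from Suc.IH[OF y(1)] obtain Q where
        Q: "Q \<subseteq> X" "finite Q" "card Q \<le> n" "Q \<subseteq> reach E Q n u" "y \<in> insert u Q"
        by blast
      have sub: "reach E Q n u \<subseteq> reach E (insert x Q) n u"
        by (rule reach_mono) auto
      have "y \<in> reach E (insert x Q) n u"
        using Q(4,5) sub reach_self[of u E] by blast
      then have "x \<in> reach E (insert x Q) (Suc n) u" using y(2) by auto
      then have "insert x Q \<subseteq> reach E (insert x Q) (Suc n) u" using Q(4) sub by auto
      moreover have "card (insert x Q) \<le> Suc n"
        using Q(2,3) by (simp add: card_insert_if)
      ultimately show ?thesis using Q y(3) by (intro exI[of _ "insert x Q"]) auto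
    qed
  qed
  then show ?thesis using that by blast
qed

lemma is_path_imp_reach:
  assumes "is_path (Graph V E) u p v" "path_length p \<le> n"
  shows "v \<in> reach E V n u"
proof -
  have "p \<noteq> [] \<Longrightarrow> hd p = u \<Longrightarrow> set p \<subseteq> V \<Longrightarrow> successively (\<lambda>x y. {x, y} \<in> E) p \<Longrightarrow>
      last p \<in> reach E V (length p - 1) u"
  proof (induction p rule: rev_induct)
    case Nil
    then show ?case by simp
  next
    case (snoc y q)
    show ?case
    proof (cases "q = []")
      case True
      then show ?thesis using snoc.prems by simp
    next
      case False
      then have "last q \<in> reach E V (length q - 1) u" "{last q, y} \<in> E"
        using snoc by (auto simp: successively_append_iff)
      then have "y \<in> reach E V (Suc (length q - 1)) u"
        using snoc.prems by (intro reach_step[of "last q"]) auto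
      then show ?thesis using False by (simp del: reach.simps)
    qed
  qed
  then have "v \<in> reach E V (path_length p) u"
    using assms(1) by (auto simp: is_path_def path_length_def)
  then show ?thesis using reach_mono[of E E V V "path_length p" n u] assms(2) by blast
qed

text \<open>A path has no repetitions, so a walk that returns to an earlier vertex is cut there.\<close>

lemma reach_imp_is_path:
  assumes "u \<in> X" "v \<in> reach E X n u" "X = verts G" "\<And>x y. x \<in> X \<Longrightarrow> y \<in> X \<Longrightarrow> {x, y} \<in> E \<Longrightarrow> {x, y} \<in> edges G"
  shows "\<exists>p. is_path G u p v \<and> path_length p \<le> n"
  using assms(2)
proof (induction n arbitrary: v)
  case 0
  then show ?case using assms(1,3) by (intro exI[of _ "[u]"]) (auto simp: is_path_def path_length_def)
next
  case (Suc n)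
  show ?case
  proof (cases "v \<in> reach E X n u")
    case True
    from Suc.IH[OF this] show ?thesis by (auto intro: le_SucI)
  next
    case False
    then obtain x where x: "x \<in> reach E X n u" "{x, v} \<in> E" "v \<in> X"
      using Suc.prems by auto
    then have xX: "x \<in> X" using assms(1) reach_subset by fastforce
    from Suc.IH[OF x(1)] obtain p where p: "is_path G u p x" "path_length p \<le> n" by blast
    show ?thesis
    proof (cases "v \<in> set p")
      case True
      then obtain q q' where q: "p = q @ v # q'" by (meson split_list)
      have "is_path G u (q @ [v]) v"
        using p(1) unfolding q is_path_def
        by (auto simp: successively_append_iff hd_append split: if_splits)
      moreover have "path_length (q @ [v]) \<le> n" using p(2) by (simp add: q path_length_def)
      ultimately show ?thesis by (meson le_SucI)
    next
      case False
      have "is_path G u (p @ [v]) v"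
        using p(1) False x assms(3) assms(4)[OF xX x(3) x(2)] unfolding is_path_def
        by (auto simp: successively_append_iff)
      moreover have "path_length (p @ [v]) \<le> Suc n"
        using p by (cases p) (auto simp: path_length_def is_path_def)
      ultimately show ?thesis by blast
    qed
  qed
qed

section \<open>Cluster models of shallow minors\<close>

text \<open>Ordered pairs are used because they are counted by summing degrees. Every edge of the contracted
  graph is counted twice.\<close>

definition adj_pairs :: "'a set set \<Rightarrow> ('a \<Rightarrow> 'a set) \<Rightarrow> 'a set \<Rightarrow> ('a \<times> 'a) set" where
  "adj_pairs E B T = {(s, t). s \<in> T \<and> t \<in> T \<and> s \<noteq> t \<and> (\<exists>x\<in>B s. \<exists>y\<in>B t. {x, y} \<in> E)}"

text \<open>Clusters are indexed by their centres, which makes the contracted graph a graph on \<open>T\<close>.\<close>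

definition cluster_model :: "'a graph \<Rightarrow> nat \<Rightarrow> 'a set \<Rightarrow> ('a \<Rightarrow> 'a set) \<Rightarrow> bool" where
  "cluster_model G D T B \<longleftrightarrow> disjoint_family_on B T \<and>
     (\<forall>t\<in>T. t \<in> B t \<and> B t \<subseteq> verts G \<and> B t \<subseteq> reach (edges G) (B t) D t)"

definition sparse_minors :: "nat \<Rightarrow> nat \<Rightarrow> 'a graph \<Rightarrow> bool" where
  "sparse_minors D k G \<longleftrightarrow>
     (\<forall>T B. cluster_model G D T B \<longrightarrow> card (adj_pairs (edges G) B T) \<le> k * card T)"

lemma finite_adj_pairs: "finite T \<Longrightarrow> finite (adj_pairs E B T)"
  by (rule finite_subset[of _ "T \<times> T"]) (auto simp: adj_pairs_def)

lemma adj_pairs_sym: "(s, t) \<in> adj_pairs E B T \<Longrightarrow> (t, s) \<in> adj_pairs E B T"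
  by (auto simp: adj_pairs_def) (metis insert_commute)

text \<open>Only the vertices in clusters are kept before contracting, so that the clusters are all the
  vertices of the minor.\<close>

lemma cluster_model_shallow_minor:
  assumes G: "fin_simple_graph G" and model: "cluster_model G D T B"
  obtains H where "shallow_minor D H G" "card (verts H) = card T"
    "card (adj_pairs (edges G) B T) \<le> 2 * card (edges H)"
proof -
  define U where "U = (\<Union>t\<in>T. B t)"
  define G' where "G' = induced_subgraph G U"
  define H where "H = contract G' (B ` T)"
  have disj: "disjoint_family_on B T" and B: "\<And>t. t \<in> T \<Longrightarrow> t \<in> B t"
    "\<And>t. t \<in> T \<Longrightarrow> B t \<subseteq> verts G" "\<And>t. t \<in> T \<Longrightarrow> B t \<subseteq> reach (edges G) (B t) D t"
    using model by (auto simp: cluster_model_def)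
  have UV: "U \<subseteq> verts G" using B(2) by (auto simp: U_def)
  have "T \<subseteq> verts G" using B(1,2) by blast
  then have finT: "finite T" using G finite_subset by (auto simp: fin_simple_graph_def)
  have inj: "inj_on B T"
    using disj B(1) by (fastforce simp: inj_on_def disjoint_family_on_def)
  have vH: "verts H = B ` T"
    by (auto simp: H_def contract_def Let_def G'_def induced_subgraph_def U_def)
  have eH: "edges H = {{X, Y} | X Y. X \<in> B ` T \<and> Y \<in> B ` T \<and> X \<noteq> Y \<and>
      (\<exists>x\<in>X. \<exists>y\<in>Y. {x, y} \<in> edges G)}"
  proof -
    have W: "B ` T \<union> {{v} |v. v \<in> verts G' - \<Union>(B ` T)} = B ` T"
      by (auto simp: G'_def induced_subgraph_def U_def)
    show ?thesis
      unfolding H_def contract_def Let_def W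
      by (auto simp: G'_def induced_subgraph_def U_def) blast+
  qed
  have "shallow_minor D H G"
    unfolding shallow_minor_def
  proof (intro exI conjI ballI)
    show "subgraph G' G"
      using UV G by (auto simp: subgraph_def G'_def induced_subgraph_def fin_simple_graph_def nsets_def)
    show "disjoint (B ` T)"
      using disj by (rule disjoint_family_on_disjoint_image)
    show "H = contract G' (B ` T)" by (fact H_def)
    fix X assume "X \<in> B ` T"
    then obtain t where t: "t \<in> T" "X = B t" by blast
    show "X \<subseteq> verts G'" using t by (auto simp: G'_def induced_subgraph_def U_def)
    let ?F = "induced_subgraph G' X"
    have vF: "X = verts ?F" by (simp add: induced_subgraph_def)
    have eF: "\<And>x y. x \<in> X \<Longrightarrow> y \<in> X \<Longrightarrow> {x, y} \<in> edges G \<Longrightarrow> {x, y} \<in> edges ?F"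
      using t by (auto simp: induced_subgraph_def G'_def U_def)
    have to_path: "\<exists>p. is_path ?F u p v \<and> path_length p \<le> n"
      if "u \<in> X" "v \<in> reach (edges G) X n u" for u v n
      using that vF by (rule reach_imp_is_path) (rule eF)
    have X: "t \<in> X" "X \<subseteq> reach (edges G) X D t" using B t by auto
    show "connected_graph ?F"
      unfolding connected_graph_def
    proof (intro conjI ballI)
      show "verts ?F \<noteq> {}" using X vF by auto
      fix u v assume "u \<in> verts ?F" "v \<in> verts ?F"
      then have uv: "u \<in> X" "v \<in> X" using vF by auto
      have "t \<in> reach (edges G) X D u" using reach_sym X uv by fast
      then have "v \<in> reach (edges G) X (D + D) u" using reach_trans X uv by fast
      then show "\<exists>p. is_path ?F u p v" using to_path uv by blast
    qed
    have "graph_dist ?F t v \<le> enat D" if vX: "v \<in> X" for v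
    proof -
      obtain p where "is_path ?F t p v" "path_length p \<le> D"
        using to_path[of t v D] X vX by blast
      then show ?thesis unfolding graph_dist_def
        by (intro INF_lower2[of p]) auto
    qed
    then show "radius ?F \<le> enat D"
      unfolding radius_def using X vF by (intro INF_lower2[of t] SUP_least) auto
  qed
  moreover have "card (verts H) = card T" using vH card_image[OF inj] by simp
  moreover have "card (adj_pairs (edges G) B T) \<le> 2 * card (edges H)"
  proof -
    have finH: "finite (edges H)"
      by (rule finite_subset[of _ "Pow (B ` T)"]) (use finT in \<open>auto simp: eH\<close>)
    \<comment> \<open>the ordered pairs that become the edge \<open>e\<close> of the minor\<close>
    define fib where "fib e = {(s, t). s \<in> T \<and> t \<in> T \<and> {B s, B t} = e}" for e
    have sub: "adj_pairs (edges G) B T \<subseteq> (\<Union>e\<in>edges H. fib e)"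
    proof clarify
      fix s t assume st: "(s, t) \<in> adj_pairs (edges G) B T"
      then have "B s \<noteq> B t" using inj by (auto simp: adj_pairs_def inj_on_def)
      then have "{B s, B t} \<in> edges H" using st unfolding adj_pairs_def eH by blast
      moreover have "(s, t) \<in> fib {B s, B t}" using st by (auto simp: adj_pairs_def fib_def)
      ultimately show "(s, t) \<in> (\<Union>e\<in>edges H. fib e)" by blast
    qed
    have fin: "finite (fib e)" for e
      by (rule finite_subset[of _ "T \<times> T"]) (use finT in \<open>auto simp: fib_def\<close>)
    have two: "card (fib e) \<le> 2" for e
    proof (cases "fib e = {}")
      case False
      then obtain s t where st: "s \<in> T" "t \<in> T" "{B s, B t} = e" by (auto simp: fib_def)
      have "fib e \<subseteq> {(s, t), (t, s)}"
      proof (rule subrelI)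
        fix s' t' assume "(s', t') \<in> fib e"
        then have "s' \<in> T" "t' \<in> T" "{B s', B t'} = {B s, B t}" using st(3) by (auto simp: fib_def)
        then have "s' = s \<and> t' = t \<or> s' = t \<and> t' = s"
          using st(1,2) inj_onD[OF inj] unfolding doubleton_eq_iff by metis
        then show "(s', t') \<in> {(s, t), (t, s)}" by blast
      qed
      then have "card (fib e) \<le> card {(s, t), (t, s)}" by (intro card_mono) auto
      also have "\<dots> \<le> 2" using card_length[of "[(s, t), (t, s)]"] by simp
      finally show ?thesis .
    qed simp
    have "card (adj_pairs (edges G) B T) \<le> card (\<Union>e\<in>edges H. fib e)"
      using sub fin finH by (intro card_mono) auto
    also have "\<dots> \<le> (\<Sum>e\<in>edges H. card (fib e))" using finH by (rule card_UN_le)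
    also have "\<dots> \<le> (\<Sum>e\<in>edges H. 2)" using two by (intro sum_mono) auto
    finally show ?thesis by simp
  qed
  ultimately show ?thesis using that by blast
qed

lemma bounded_expansion_sparse_minors:
  assumes "graph_class \<C>" "bounded_expansion \<C>"
  shows "\<exists>k. \<forall>G\<in>\<C>. sparse_minors D k G"
proof -
  obtain k :: real where k: "\<And>G H. G \<in> \<C> \<Longrightarrow> shallow_minor D H G \<Longrightarrow>
      real (card (edges H)) \<le> k * real (card (verts H))"
    using assms(2) unfolding bounded_expansion_def by meson
  define k' where "k' = nat \<lceil>k\<rceil>"
  have "sparse_minors D (2 * k') G" if "G \<in> \<C>" for G
    unfolding sparse_minors_def
  proof (intro allI impI)
    fix T B assume "cluster_model G D T B"
    moreover have "fin_simple_graph G" using assms(1) that by (auto simp: graph_class_def)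
    ultimately obtain H where H: "shallow_minor D H G" "card (verts H) = card T"
      "card (adj_pairs (edges G) B T) \<le> 2 * card (edges H)"
      using cluster_model_shallow_minor by blast
    have "real (card (edges H)) \<le> k * real (card T)" using k[OF that H(1)] H(2) by simp
    also have "\<dots> \<le> real k' * real (card T)"
      unfolding k'_def by (intro mult_right_mono) (auto intro: real_nat_ceiling_ge)
    finally have "card (edges H) \<le> k' * card T" by (metis of_nat_le_iff of_nat_mult)
    then show "card (adj_pairs (edges G) B T) \<le> 2 * k' * card T" using H(3) by simp
  qed
  then show ?thesis by blast
qed

text \<open>Every induced subgraph of the contracted graph has a vertex of degree at most \<open>k\<close>. Choosing it and
  discarding its neighbours uses up at most \<open>k + 1\<close> vertices per chosen vertex.\<close>

lemma sparse_independent_set: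
  assumes "finite S"
    and sparse: "\<And>S'. S' \<subseteq> S \<Longrightarrow> card (adj_pairs E B S') \<le> k * card S'"
  shows "\<exists>I\<subseteq>S. adj_pairs E B I = {} \<and> card S \<le> (k + 1) * card I"
  using assms
proof (induction S rule: finite_psubset_induct)
  case (psubset S)
  show ?case
  proof (cases "S = {}")
    case True
    then show ?thesis by (auto simp: adj_pairs_def)
  next
    case False
    define nb where "nb s = {t. (s, t) \<in> adj_pairs E B S}" for s
    have fin: "finite (nb s)" for s
      by (rule finite_subset[of _ S]) (use psubset.hyps in \<open>auto simp: nb_def adj_pairs_def\<close>)
    have "\<exists>s\<in>S. card (nb s) \<le> k"
    proof (rule ccontr)
      assume "\<not> ?thesis"
      then have big: "\<And>s. s \<in> S \<Longrightarrow> k + 1 \<le> card (nb s)" by force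
      have "adj_pairs E B S = Sigma S nb" by (fastforce simp: nb_def adj_pairs_def)
      then have "card (adj_pairs E B S) = (\<Sum>s\<in>S. card (nb s))" using psubset(1) fin by simp
      also have "\<dots> \<ge> (\<Sum>s\<in>S. k + 1)" using big by (intro sum_mono)
      finally have "(k + 1) * card S \<le> card (adj_pairs E B S)" by (simp add: mult.commute)
      moreover have "card S > 0" using False psubset.hyps by (simp add: card_gt_0_iff)
      ultimately show False using psubset.prems[of S] by simp
    qed
    then obtain s where s: "s \<in> S" "card (nb s) \<le> k" by blast
    define S' where "S' = S - insert s (nb s)"
    have "S' \<subset> S" using s by (auto simp: S'_def)
    have "\<exists>I\<subseteq>S'. adj_pairs E B I = {} \<and> card S' \<le> (k + 1) * card I"
      by (rule psubset.IH[OF \<open>S' \<subset> S\<close>], rule psubset.prems) (use \<open>S' \<subset> S\<close> in blast)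
    then obtain I where I: "I \<subseteq> S'" "adj_pairs E B I = {}" "card S' \<le> (k + 1) * card I"
      by blast
    have finI: "finite I" using I(1) psubset(1) \<open>S' \<subset> S\<close> by (meson finite_subset psubsetE)
    have "adj_pairs E B (insert s I) = {}"
    proof -
      have no: "(s, t) \<notin> adj_pairs E B (insert s I)" if "t \<in> I" for t
      proof
        assume "(s, t) \<in> adj_pairs E B (insert s I)"
        moreover have "insert s I \<subseteq> S" using I(1) s(1) \<open>S' \<subset> S\<close> by blast
        ultimately have "(s, t) \<in> adj_pairs E B S" unfolding adj_pairs_def by blast
        then show False using that I(1) by (auto simp: S'_def nb_def)
      qed
      have "(a, b) \<notin> adj_pairs E B (insert s I)" for a b
      proof
        assume ab: "(a, b) \<in> adj_pairs E B (insert s I)"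
        then have "a \<noteq> b" "a \<in> insert s I" "b \<in> insert s I" unfolding adj_pairs_def by blast+
        then consider "a = s" "b \<in> I" | "b = s" "a \<in> I" | "a \<in> I" "b \<in> I" by blast
        then show False
        proof cases
          case 1
          then show ?thesis using ab no by blast
        next
          case 2
          then show ?thesis using adj_pairs_sym[OF ab] no by blast
        next
          case 3
          then have "(a, b) \<in> adj_pairs E B I" using ab unfolding adj_pairs_def by blast
          then show ?thesis using I(2) by blast
        qed
      qed
      then show ?thesis by auto
    qed
    moreover have "s \<notin> I" using I(1) by (auto simp: S'_def)
    moreover have "card S \<le> card S' + card (insert s (nb s))"
    proof -
      have "S \<subseteq> S' \<union> insert s (nb s)" by (auto simp: S'_def)
      then have "card S \<le> card (S' \<union> insert s (nb s))"
        using fin \<open>S' \<subset> S\<close> psubset(1) by (intro card_mono) (auto intro: finite_subset)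
      also have "\<dots> \<le> card S' + card (insert s (nb s))" by (rule card_Un_le)
      finally show ?thesis .
    qed
    moreover have "card (insert s (nb s)) \<le> k + 1" using s(2) fin by (simp add: card_insert_if)
    ultimately have "card S \<le> (k + 1) * card (insert s I)" using I(3) finI by simp
    moreover have "insert s I \<subseteq> S" using I(1) s(1) \<open>S' \<subset> S\<close> by blast
    ultimately show ?thesis using \<open>adj_pairs E B (insert s I) = {}\<close> by blast
  qed
qed

section \<open>Vertices separated from a set by few vertices\<close>

lemma cluster_model_subset:
  "cluster_model G D T B \<Longrightarrow> T' \<subseteq> T \<Longrightarrow> cluster_model G D T' B"
  by (auto simp: cluster_model_def intro: disjoint_family_on_mono)

text \<open>Among all models with centres \<open>S\<close> in which the number of other cluster vertices is at most \<open>D\<close> times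
  the number of adjacent pairs, take one with the most adjacent pairs. If a walk of length at most
  \<open>D + 1\<close> through unused vertices joined two nonadjacent centres, then the cluster of its first end
  could absorb the walk: the new adjacency pays for the at most \<open>D\<close> new vertices, which contradicts
  maximality. Since the number of adjacent pairs is linear in \<open>S\<close>, so is the number of vertices in \<open>M\<close>.\<close>

lemma saturated_cluster_model:
  assumes G: "fin_simple_graph G" and sparse: "sparse_minors D k G" and S: "S \<subseteq> verts G"
  obtains B M where "cluster_model G D S B" "(\<Union>s\<in>S. B s) = M \<union> S" "M \<inter> S = {}"
    "card M \<le> D * card (adj_pairs (edges G) B S)"
    "\<And>u v z. u \<in> S \<Longrightarrow> v \<in> S \<Longrightarrow> u \<noteq> v \<Longrightarrow> z \<in> reach (edges G) (verts G - (M \<union> S)) D u \<Longrightarrow>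
       {z, v} \<in> edges G \<Longrightarrow> (u, v) \<in> adj_pairs (edges G) B S"
proof -
  let ?E = "edges G"
  have finV: "finite (verts G)" using G by (simp add: fin_simple_graph_def)
  have finS: "finite S" using finV S finite_subset by blast
  define good where "good B \<longleftrightarrow> cluster_model G D S B \<and> (\<forall>s\<in>S. B s \<inter> S = {s}) \<and>
      card ((\<Union>s\<in>S. B s) - S) \<le> D * card (adj_pairs ?E B S)" for B
  have "good (\<lambda>s. {s})"
    using S by (auto simp: good_def cluster_model_def disjoint_family_on_def reach_self)
  moreover have "\<forall>B. good B \<longrightarrow> card (adj_pairs ?E B S) \<le> k * card S"
    using sparse by (simp add: good_def sparse_minors_def)
  ultimately obtain B where B: "good B"
    and max: "\<And>B'. good B' \<Longrightarrow> card (adj_pairs ?E B' S) \<le> card (adj_pairs ?E B S)"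
    using ex_has_greatest_nat[of good _ "\<lambda>B. card (adj_pairs ?E B S)"] by (metis less_Suc_eq_le)
  define M where "M = (\<Union>s\<in>S. B s) - S"
  have model: "cluster_model G D S B" and BS: "\<And>s. s \<in> S \<Longrightarrow> B s \<inter> S = {s}"
    using B by (auto simp: good_def)
  have un: "(\<Union>s\<in>S. B s) = M \<union> S" using BS by (auto simp: M_def)
  have finM: "finite M"
    using model finV unfolding M_def cluster_model_def by (meson UN_least finite_Diff finite_subset)
  show ?thesis
  proof (rule that)
    show "cluster_model G D S B" by fact
    show "(\<Union>s\<in>S. B s) = M \<union> S" by fact
    show "M \<inter> S = {}" by (auto simp: M_def)
    show "card M \<le> D * card (adj_pairs ?E B S)" using B by (simp add: good_def M_def)
    fix u v z
    assume u: "u \<in> S" and v: "v \<in> S" and uv: "u \<noteq> v"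
      and z: "z \<in> reach ?E (verts G - (M \<union> S)) D u" and zv: "{z, v} \<in> ?E"
    show "(u, v) \<in> adj_pairs ?E B S"
    proof (rule ccontr)
      assume new: "(u, v) \<notin> adj_pairs ?E B S"
      obtain Q where Q: "Q \<subseteq> verts G - (M \<union> S)" "finite Q" "card Q \<le> D"
        "Q \<subseteq> reach ?E Q D u" "z \<in> insert u Q"
        using reach_small_witness[OF z] by blast
      define B' where "B' = B(u := B u \<union> Q)"
      have sup: "B s \<subseteq> B' s" for s by (auto simp: B'_def)
      have QB: "Q \<inter> B s = {}" if "s \<in> S" for s using Q(1) un that by blast
      have "disjoint_family_on B' S"
        using model QB unfolding cluster_model_def disjoint_family_on_def B'_def
        by (auto simp: Int_Un_distrib Int_Un_distrib2 Int_commute)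
      moreover have "B' s \<subseteq> reach ?E (B' s) D s" if "s \<in> S" for s
      proof (cases "s = u")
        case True
        have "B u \<subseteq> reach ?E (B' u) D u"
          using model u sup[of u] reach_mono[of ?E ?E "B u" "B' u" D D u]
          unfolding cluster_model_def by blast
        moreover have "Q \<subseteq> reach ?E (B' u) D u"
          using Q(4) reach_mono[of ?E ?E Q "B' u" D D u] by (auto simp: B'_def)
        ultimately show ?thesis using True by (auto simp: B'_def)
      next
        case False
        then show ?thesis using model that by (auto simp: B'_def cluster_model_def)
      qed
      moreover have "s \<in> B' s" "B' s \<subseteq> verts G" if "s \<in> S" for s
        using model Q(1) that by (auto simp: B'_def cluster_model_def)
      ultimately have "cluster_model G D S B'" by (simp add: cluster_model_def)
      moreover have "\<forall>s\<in>S. B' s \<inter> S = {s}"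
        using BS Q(1) by (auto simp: B'_def)
      moreover have more: "card (adj_pairs ?E B' S) \<ge> card (adj_pairs ?E B S) + 1"
      proof -
        have "z \<in> B' u" using Q(5) model u by (auto simp: B'_def cluster_model_def)
        moreover have "v \<in> B' v" using model v sup[of v] by (auto simp: cluster_model_def)
        ultimately have "(u, v) \<in> adj_pairs ?E B' S"
          using u v uv zv by (auto simp: adj_pairs_def)
        moreover have "adj_pairs ?E B S \<subseteq> adj_pairs ?E B' S"
          using sup by (fastforce simp: adj_pairs_def)
        ultimately have "insert (u, v) (adj_pairs ?E B S) \<subseteq> adj_pairs ?E B' S" by blast
        from card_mono[OF finite_adj_pairs[OF finS] this] new show ?thesis
          using finite_adj_pairs[OF finS] by simp
      qed
      moreover have "card ((\<Union>s\<in>S. B' s) - S) \<le> D * card (adj_pairs ?E B' S)"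
      proof -
        have "(\<Union>s\<in>S. B' s) - S \<subseteq> M \<union> Q" by (auto simp: B'_def M_def split: if_splits)
        then have "card ((\<Union>s\<in>S. B' s) - S) \<le> card (M \<union> Q)"
          using finM Q(2) by (intro card_mono) auto
        also have "\<dots> \<le> card M + card Q" by (rule card_Un_le)
        also have "\<dots> \<le> D * (card (adj_pairs ?E B S) + 1)"
          using B Q(3) by (simp add: good_def M_def)
        also have "\<dots> \<le> D * card (adj_pairs ?E B' S)" using more by (intro mult_left_mono) auto
        finally show ?thesis .
      qed
      ultimately have "good B'" by (simp add: good_def)
      with max[OF this] more show False by simp
    qed
  qed
qed

text \<open>At most \<open>K\<close> vertices meet every walk of length at most \<open>n\<close> from \<open>v\<close> to \<open>L\<close>. The vertex \<open>v\<close>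
  itself may be among them, but as \<open>reach\<close> does not require its start to be allowed, this removes
  only walks that return to \<open>v\<close>.\<close>

abbreviation separable :: "'a graph \<Rightarrow> nat \<Rightarrow> nat \<Rightarrow> 'a \<Rightarrow> 'a set \<Rightarrow> bool" where
  "separable G K n v L \<equiv>
     \<exists>T. finite T \<and> card T \<le> K \<and> reach (edges G) (verts G - T) n v \<inter> L = {}"

text \<open>In a saturated model with used vertices \<open>M\<close>, let \<open>C v\<close> be the vertices reached from \<open>v\<close> in \<open>r\<close> steps
  through unused vertices, and \<open>Z v\<close> the vertices of \<open>M \<union> S\<close>, other than \<open>v\<close>, that have a neighbour in
  \<open>C v\<close>. The first vertex of \<open>M \<union> S - {v}\<close> on a walk from \<open>v\<close> lies in \<open>Z v\<close>, so \<open>Z v\<close> separates \<open>v\<close> from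
  the rest of \<open>S\<close>.

  Some \<open>Z v\<close> is small. Saturation makes the sets \<open>C v\<close>, for \<open>v\<close> in an independent set \<open>I\<close> of the
  contracted graph, disjoint and pairwise nonadjacent. Together with the singletons of
  \<open>M \<union> S - I\<close> they form a second model, in which \<open>v\<close> has degree at least \<open>card (Z v)\<close>. It has linearly many
  clusters and hence linearly many edges, and \<open>I\<close> contains a constant fraction of \<open>S\<close>.\<close>

lemma exists_separated_vertex:
  assumes G: "fin_simple_graph G" and sparse: "sparse_minors (2 * r + 1) k G"
    and S: "S \<subseteq> verts G" "S \<noteq> {}"
  shows "\<exists>v\<in>S. separable G (k * ((2 * r + 1) * k + 1) * (k + 1)) (r + 1) v (S - {v})"
proof -
  let ?E = "edges G" and ?D = "2 * r + 1"
  have finV: "finite (verts G)" using G by (simp add: fin_simple_graph_def)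
  have finS: "finite S" using finV S finite_subset by blast
  obtain B M where model: "cluster_model G ?D S B" and un: "(\<Union>s\<in>S. B s) = M \<union> S"
    and MS: "M \<inter> S = {}" and cM: "card M \<le> ?D * card (adj_pairs ?E B S)"
    and sat: "\<And>u v z. u \<in> S \<Longrightarrow> v \<in> S \<Longrightarrow> u \<noteq> v \<Longrightarrow>
       z \<in> reach ?E (verts G - (M \<union> S)) ?D u \<Longrightarrow> {z, v} \<in> ?E \<Longrightarrow> (u, v) \<in> adj_pairs ?E B S"
    using saturated_cluster_model[OF G sparse S(1)] by blast
  define X where "X = verts G - (M \<union> S)"
  define C where "C v = reach ?E X r v" for v
  define Z where "Z v = {z \<in> M \<union> S - {v}. \<exists>x\<in>C v. {x, z} \<in> ?E}" for v
  have MSV: "M \<union> S \<subseteq> verts G" using model un[symmetric] by (auto simp: cluster_model_def)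
  have finMS: "finite (M \<union> S)" using MSV finV finite_subset by blast
  have finZ: "finite (Z v)" for v
    by (rule finite_subset[OF _ finMS]) (auto simp: Z_def)
  have CX: "C v \<subseteq> insert v X" for v unfolding C_def by (rule reach_subset)
  have Z_sep: "reach ?E (verts G - Z v) (r + 1) v \<inter> (S - {v}) = {}" for v
  proof -
    have "reach ?E (verts G - Z v) n v \<subseteq> reach ?E X n v" if "n \<le> r + 1" for n
      using that
    proof (induction n)
      case 0
      then show ?case by simp
    next
      case (Suc n)
      have sub: "reach ?E X n v \<subseteq> C v"
        unfolding C_def by (rule reach_mono) (use Suc.prems in auto)
      have "y \<in> reach ?E X (Suc n) v"
        if y: "y \<in> verts G - Z v" and x: "x \<in> reach ?E X n v" "{x, y} \<in> ?E" for x y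
      proof (cases "y \<in> X \<or> y = v")
        case True
        then show ?thesis using x reach_self by fastforce
      next
        case False
        then have "y \<in> Z v" using y x sub by (auto simp: X_def Z_def)
        then show ?thesis using y by blast
      qed
      then show ?case using Suc by auto
    qed
    then have "reach ?E (verts G - Z v) (r + 1) v \<subseteq> insert v X"
      using reach_subset by (meson le_refl order_trans)
    moreover have "X \<inter> S = {}" by (auto simp: X_def)
    ultimately show ?thesis by blast
  qed
  \<comment> \<open>two balls of radius \<open>r\<close> and an edge between them give a walk of length at most \<open>2 * r + 1\<close>\<close>
  have linked: "(u, v) \<in> adj_pairs ?E B S"
    if uv: "u \<in> S" "v \<in> S" "u \<noteq> v" and xy: "x \<in> C u" "y \<in> C v" "x = y \<or> {x, y} \<in> ?E" for u v x y
  proof (rule ccontr)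
    assume no: "(u, v) \<notin> adj_pairs ?E B S"
    have vX: "v \<notin> X" using uv by (simp add: X_def)
    have "\<exists>z\<in>reach ?E X ?D u. {z, v} \<in> ?E"
    proof (cases "y \<in> reach ?E X (r + 1) u")
      case True
      have "\<exists>z\<in>reach ?E X (r + 1 + r) u. {z, v} \<in> ?E"
        using vX uv(3)[symmetric] xy(2)[unfolded C_def] True by (rule reach_meet)
      moreover have "r + 1 + r = ?D" by simp
      ultimately show ?thesis by (simp only:)
    next
      case False
      then have ny: "x \<noteq> y" "y \<notin> X"
        using xy reach_mono[of ?E ?E X X r "r + 1" u] by (auto simp: C_def)
      then have "y = v" using xy(2) CX by blast
      then have "{x, v} \<in> ?E" using xy ny by simp
      moreover have "x \<in> reach ?E X ?D u"
        using xy(1) reach_mono[of ?E ?E X X r ?D u] unfolding C_def by auto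
      ultimately show ?thesis by blast
    qed
    then show False using sat uv no unfolding X_def by blast
  qed
  have "card (adj_pairs ?E B S') \<le> k * card S'" if "S' \<subseteq> S" for S'
    using cluster_model_subset[OF model that] sparse by (simp add: sparse_minors_def)
  from sparse_independent_set[OF finS this] obtain I where
    I: "I \<subseteq> S" "adj_pairs ?E B I = {}" "card S \<le> (k + 1) * card I" by blast
  have indep: "(u, v) \<notin> adj_pairs ?E B S" if "u \<in> I" "v \<in> I" for u v
    using that I(2) by (auto simp: adj_pairs_def)
  define B' where "B' t = (if t \<in> I then C t else {t})" for t
  have model': "cluster_model G ?D (M \<union> S) B'"
    unfolding cluster_model_def
  proof (intro conjI ballI)
    show "disjoint_family_on B' (M \<union> S)"
      unfolding disjoint_family_on_def
    proof (intro ballI impI)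
      fix s t assume st: "s \<in> M \<union> S" "t \<in> M \<union> S" "s \<noteq> t"
      have "C s \<inter> C t = {}" if "s \<in> I" "t \<in> I"
        using linked[of s t] indep that st I(1) by blast
      moreover have "s \<notin> X" "t \<notin> X" using st by (auto simp: X_def)
      ultimately show "B' s \<inter> B' t = {}" using CX st by (auto simp: B'_def)
    qed
    fix t assume t: "t \<in> M \<union> S"
    show "t \<in> B' t" by (simp add: B'_def C_def reach_self)
    show "B' t \<subseteq> verts G" using t MSV CX[of t] by (auto simp: B'_def X_def)
    have "C t \<subseteq> reach ?E (C t) ?D t"
      using reach_within_reach[of ?E X r t] reach_mono[of ?E ?E "C t" "C t" r ?D t]
      unfolding C_def by auto
    then show "B' t \<subseteq> reach ?E (B' t) ?D t"
      by (auto simp: B'_def reach_self)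
  qed
  define K where "K = k * (?D * k + 1) * (k + 1)"
  have "\<exists>v\<in>S. card (Z v) \<le> K"
  proof (rule ccontr)
    assume "\<not> ?thesis"
    then have big: "\<And>v. v \<in> I \<Longrightarrow> K + 1 \<le> card (Z v)" using I(1) by force
    have finI: "finite I" using I(1) finS finite_subset by blast
    have "Sigma I Z \<subseteq> adj_pairs ?E B' (M \<union> S)"
    proof clarify
      fix v z assume v: "v \<in> I" and z: "z \<in> Z v"
      then obtain x where x: "x \<in> C v" "{x, z} \<in> ?E" "z \<in> M \<union> S" "z \<noteq> v" by (auto simp: Z_def)
      have "z \<notin> I"
        using linked[of v z x z] indep[of v z] v x I(1) reach_self[of z ?E X r] by (auto simp: C_def)
      then show "(v, z) \<in> adj_pairs ?E B' (M \<union> S)"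
        using x v I(1) by (auto simp: adj_pairs_def B'_def)
    qed
    then have "card (Sigma I Z) \<le> card (adj_pairs ?E B' (M \<union> S))"
      by (rule card_mono[OF finite_adj_pairs[OF finMS]])
    also have "\<dots> \<le> k * card (M \<union> S)" using sparse model' by (simp add: sparse_minors_def)
    also have "\<dots> \<le> k * (?D * (k * card S) + card S)"
    proof -
      have "card (adj_pairs ?E B S) \<le> k * card S" using sparse model by (simp add: sparse_minors_def)
      then have "card M \<le> ?D * (k * card S)" using cM by (meson le_trans mult_le_mono2)
      then show ?thesis using card_Un_le[of M S] by (intro mult_le_mono2) simp
    qed
    also have "\<dots> = k * (?D * k + 1) * card S" by (simp add: algebra_simps)
    also have "\<dots> \<le> k * (?D * k + 1) * ((k + 1) * card I)" using I(3) by (rule mult_le_mono2)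
    also have "\<dots> = K * card I" by (simp only: K_def mult.assoc)
    finally have "card (Sigma I Z) \<le> K * card I" .
    moreover have "card (Sigma I Z) = (\<Sum>v\<in>I. card (Z v))" using finI finZ by simp
    moreover have "(\<Sum>v\<in>I. K + 1) \<le> (\<Sum>v\<in>I. card (Z v))" using big by (intro sum_mono)
    ultimately have "card I = 0" by (simp add: algebra_simps)
    then show False using I(3) S(2) finS by simp
  qed
  then show ?thesis using Z_sep finZ unfolding K_def by blast
qed

text \<open>A walk from \<open>v\<close> that leaves the complement of \<open>L\<close> with its last step meets the separator \<open>T\<close> of \<open>v\<close>. It
  either ends there, or continues from a vertex of \<open>T\<close> outside \<open>L\<close> as a shorter walk of the same kind.
  So each step of the recursion costs a factor \<open>K\<close>.\<close>

lemma card_boundary_le: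
  assumes sep: "\<And>v. v \<in> verts G - L \<Longrightarrow> separable G K (r + 1) v L"
    and L: "L \<subseteq> verts G" and K: "1 \<le> K" and n: "n \<le> r" and v: "v \<in> verts G - L"
  shows "finite {w \<in> L. \<exists>u\<in>reach (edges G) (verts G - L) n v. {u, w} \<in> edges G} \<and>
         card {w \<in> L. \<exists>u\<in>reach (edges G) (verts G - L) n v. {u, w} \<in> edges G} \<le> K ^ (n + 1)"
  using n v
proof (induction n arbitrary: v rule: less_induct)
  case (less n)
  let ?E = "edges G" and ?V = "verts G"
  define bd where "bd m v = {w \<in> L. \<exists>u\<in>reach ?E (?V - L) m v. {u, w} \<in> ?E}" for m v
  obtain T where T: "finite T" "card T \<le> K" "reach ?E (?V - T) (r + 1) v \<inter> L = {}"
    using sep less.prems by blast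
  define part where "part s = (if s \<in> ?V - L \<and> n > 0 then bd (n - 1) s else {s})" for s
  have "bd n v \<subseteq> (\<Union>s\<in>T. part s)"
  proof
    fix w assume "w \<in> bd n v"
    then obtain u where w: "w \<in> L" and u: "u \<in> reach ?E (?V - L) n v" "{u, w} \<in> ?E"
      by (auto simp: bd_def)
    from reach_split[OF u(1), of T] show "w \<in> (\<Union>s\<in>T. part s)"
    proof
      assume "u \<in> reach ?E (?V - L - T) n v"
      then have "u \<in> reach ?E (?V - T) r v"
        using reach_mono[of ?E ?E "?V - L - T" "?V - T" n r v] less.prems(1) by blast
      then have "w \<in> T" using reach_step[of u ?E "?V - T" r v w] u(2) w L T(3) by auto
      then show ?thesis using w by (auto simp: part_def)
    next
      assume "\<exists>s\<in>T \<inter> (?V - L). \<exists>m<n. u \<in> reach ?E (?V - L) m s"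
      then obtain s m where s: "s \<in> T" "s \<in> ?V - L" "m < n" "u \<in> reach ?E (?V - L) m s" by blast
      then have "u \<in> reach ?E (?V - L) (n - 1) s"
        using reach_mono[of ?E ?E "?V - L" "?V - L" m "n - 1" s] by fastforce
      then have "w \<in> part s" using s u(2) w by (auto simp: part_def bd_def)
      then show ?thesis using s(1) by blast
    qed
  qed
  moreover have part: "finite (part s) \<and> card (part s) \<le> K ^ n" for s
  proof (cases "s \<in> ?V - L \<and> n > 0")
    case True
    then show ?thesis using less.IH[of "n - 1" s] less.prems(1) by (simp add: part_def bd_def)
  next
    case False
    then show ?thesis using K by (auto simp: part_def)
  qed
  moreover have "card (\<Union>s\<in>T. part s) \<le> K ^ (n + 1)"
  proof -
    have "card (\<Union>s\<in>T. part s) \<le> (\<Sum>s\<in>T. card (part s))" using T(1) by (rule card_UN_le)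
    also have "\<dots> \<le> (\<Sum>s\<in>T. K ^ n)" using part by (intro sum_mono) auto
    also have "\<dots> \<le> K ^ (n + 1)" using T(2) by simp
    finally show ?thesis .
  qed
  ultimately have "finite (bd n v) \<and> card (bd n v) \<le> K ^ (n + 1)"
    using T(1) by (meson card_mono finite_UN_I finite_subset le_trans)
  then show ?case by (simp add: bd_def)
qed

section \<open>Construction sequences of bounded width\<close>

text \<open>Partitions are given by labellings: the number of parts that a set meets is then the number of
  labels on it, and merging two parts identifies two labels.\<close>

definition parts_of :: "'a set \<Rightarrow> ('a \<Rightarrow> 'b) \<Rightarrow> 'a set set" where
  "parts_of V f = (\<lambda>x. {y \<in> V. f y = f x}) ` V"

definition narrow :: "nat \<Rightarrow> 'a set \<Rightarrow> nat \<Rightarrow> 'a config \<Rightarrow> bool" where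
  "narrow r V W c \<longleftrightarrow> (\<forall>v\<in>V. card (reachable_parts r V c v) \<le> W)"

definition narrow_step :: "nat \<Rightarrow> 'a set \<Rightarrow> nat \<Rightarrow> 'a config \<Rightarrow> 'a config \<Rightarrow> bool" where
  "narrow_step r V W c c' \<longleftrightarrow> construction_step c c' \<and> narrow r V W c'"

text \<open>The edge set \<open>F\<close> is an upper bound for the resolved pairs. With it, one count of labels covers all
  configurations met while a group of pairs is being resolved.\<close>

lemma narrow_parts_of:
  assumes "finite V" "E \<union> N \<subseteq> F"
    "\<And>v. v \<in> V \<Longrightarrow> card (f ` reach F V r v) \<le> W"
  shows "narrow r V W (Config (parts_of V f) E N U)"
  unfolding narrow_def
proof
  fix v assume v: "v \<in> V"
  have fin: "finite (reach F V r v)"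
    using reach_subset[of F V r v] assms(1) by (meson finite.insertI finite_subset)
  have "reachable_parts r V (Config (parts_of V f) E N U) v \<subseteq>
      (\<lambda>a. {y \<in> V. f y = a}) ` (f ` reach F V r v)"
  proof
    fix A assume "A \<in> reachable_parts r V (Config (parts_of V f) E N U) v"
    then obtain u p where A: "A \<in> parts_of V f" "u \<in> A"
      "is_path (Graph V (E \<union> N)) v p u" "path_length p \<le> r"
      by (auto simp: reachable_parts_def)
    have "u \<in> reach F V r v"
      using is_path_imp_reach[OF A(3,4)] reach_mono[OF assms(2), of V V r r v] by blast
    moreover have "A = {y \<in> V. f y = f u}" using A(1,2) by (auto simp: parts_of_def)
    ultimately show "A \<in> (\<lambda>a. {y \<in> V. f y = a}) ` (f ` reach F V r v)" by blast
  qed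
  then have "card (reachable_parts r V (Config (parts_of V f) E N U) v) \<le> card (f ` reach F V r v)"
    using fin by (meson card_image_le card_mono finite_imageI le_trans)
  then show "card (reachable_parts r V (Config (parts_of V f) E N U) v) \<le> W"
    using assms(3)[OF v] by simp
qed

text \<open>Merging can only decrease the number of parts a vertex reaches, so the intermediate partitions
  inherit the bound of the initial one.\<close>

lemma narrow_coarsening:
  assumes "finite V" "E \<union> N \<subseteq> F"
    and "\<And>v. v \<in> V \<Longrightarrow> card (f ` reach F V r v) \<le> W"
    and "\<And>x y. x \<in> V \<Longrightarrow> y \<in> V \<Longrightarrow> f x = f y \<Longrightarrow> g x = g y"
  shows "(narrow_step r V W)\<^sup>*\<^sup>* (Config (parts_of V f) E N U) (Config (parts_of V g) E N U)"
  using assms(3,4)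
proof (induction "card (f ` V)" arbitrary: f rule: less_induct)
  case less
  show ?case
  proof (cases "\<forall>x\<in>V. \<forall>y\<in>V. g x = g y \<longrightarrow> f x = f y")
    case True
    then have "\<forall>x\<in>V. {y \<in> V. f y = f x} = {y \<in> V. g y = g x}" using less.prems(2) by blast
    then have "parts_of V f = parts_of V g" unfolding parts_of_def by (intro image_cong) auto
    then show ?thesis by simp
  next
    case False
    then obtain x y where xy: "x \<in> V" "y \<in> V" "g x = g y" "f x \<noteq> f y" by blast
    \<comment> \<open>merging two parts means renaming one label to the other\<close>
    define h where "h a = (if a = f x then f y else a)" for a
    define f' where "f' z = h (f z)" for z
    have f'_im: "f' ` R = h ` f ` R" for R by (auto simp: f'_def)
    have "f' ` V \<subseteq> f ` V - {f x}" using xy by (auto simp: f'_def h_def)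
    then have smaller: "card (f' ` V) < card (f ` V)"
      using xy(1) assms(1) by (intro psubset_card_mono) auto
    have w: "card (f' ` reach F V r v) \<le> W" if "v \<in> V" for v
    proof -
      have "finite (reach F V r v)"
        using reach_subset[of F V r v] assms(1) by (meson finite.insertI finite_subset)
      then show ?thesis
        unfolding f'_im using less.prems(1)[OF that] by (meson card_image_le finite_imageI le_trans)
    qed
    have refine: "g a = g b" if "a \<in> V" "b \<in> V" "f' a = f' b" for a b
      using that less.prems(2) xy unfolding f'_def h_def by (metis (full_types))
    let ?A = "{z \<in> V. f z = f x}" and ?B = "{z \<in> V. f z = f y}"
    have "?A \<in> parts_of V f" "?B \<in> parts_of V f" using xy by (auto simp: parts_of_def)
    moreover have "?A \<noteq> ?B" using xy by auto
    ultimately have "construction_step (Config (parts_of V f) E N U)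
        (Config (insert (?A \<union> ?B) (parts_of V f - {?A, ?B})) E N U)"
      by (rule construction_step.merge)
    moreover have "insert (?A \<union> ?B) (parts_of V f - {?A, ?B}) = parts_of V f'"
    proof -
      have 1: "{z \<in> V. f' z = f' a} = ?A \<union> ?B" if "a \<in> ?A \<union> ?B" for a
      proof -
        have a: "f' a = f y" using that by (auto simp: f'_def h_def)
        have z: "f' z = f y \<longleftrightarrow> f z = f x \<or> f z = f y" for z by (simp add: f'_def h_def)
        have "{z \<in> V. f' z = f' a} = {z \<in> V. f z = f x \<or> f z = f y}" unfolding a z ..
        also have "\<dots> = ?A \<union> ?B" by blast
        finally show ?thesis .
      qed
      have 2: "{z \<in> V. f' z = f' a} = {z \<in> V. f z = f a}" if "a \<in> V - (?A \<union> ?B)" for a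
      proof -
        have a: "f a \<noteq> f x" "f a \<noteq> f y" using that by auto
        then have b: "f' a = f a" by (simp add: f'_def h_def)
        have z: "f' z = f a \<longleftrightarrow> f z = f a" for z using a by (auto simp: f'_def h_def)
        show ?thesis unfolding b z ..
      qed
      have 3: "parts_of V f - {?A, ?B} = (\<lambda>a. {z \<in> V. f z = f a}) ` (V - (?A \<union> ?B))"
        by (auto simp: parts_of_def)
      have V: "(?A \<union> ?B) \<union> (V - (?A \<union> ?B)) = V" by auto
      have "parts_of V f' = (\<lambda>a. {z \<in> V. f' z = f' a}) ` (?A \<union> ?B)
          \<union> (\<lambda>a. {z \<in> V. f' z = f' a}) ` (V - (?A \<union> ?B))"
        unfolding image_Un[symmetric] V parts_of_def ..
      also have "(\<lambda>a. {z \<in> V. f' z = f' a}) ` (?A \<union> ?B) = (\<lambda>a. ?A \<union> ?B) ` (?A \<union> ?B)"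
        using 1 by (intro image_cong) auto
      also have "\<dots> = {?A \<union> ?B}" using xy(1) by blast
      also have "(\<lambda>a. {z \<in> V. f' z = f' a}) ` (V - (?A \<union> ?B)) = parts_of V f - {?A, ?B}"
        unfolding 3 using 2 by (intro image_cong) auto
      finally show ?thesis by simp
    qed
    moreover have "narrow r V W (Config (parts_of V f') E N U)"
      using assms(1,2) w by (rule narrow_parts_of)
    ultimately have "narrow_step r V W (Config (parts_of V f) E N U) (Config (parts_of V f') E N U)"
      by (simp add: narrow_step_def)
    then show ?thesis
      using less.hyps[OF smaller w refine] by (meson converse_rtranclp_into_rtranclp)
  qed
qed

text \<open>Here \<open>\<A>\<close> is a set of parts all of whose vertices are adjacent to \<open>v\<close> in \<open>F\<close>.\<close>

lemma narrow_resolve: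
  assumes "finite V" and v: "{v} \<in> parts_of V f" and \<A>: "finite \<A>" "\<A> \<subseteq> parts_of V f"
    and E: "E \<subseteq> F" and new: "\<And>A a. A \<in> \<A> \<Longrightarrow> a \<in> A \<Longrightarrow> {v, a} \<in> F" and F: "F \<subseteq> nsets V 2"
    and w: "\<And>x. x \<in> V \<Longrightarrow> card (f ` reach F V r x) \<le> W"
  shows "(narrow_step r V W)\<^sup>*\<^sup>* (Config (parts_of V f) E {} (nsets V 2 - E))
     (Config (parts_of V f) (E \<union> {{v, a} | a. a \<in> \<Union>\<A>}) {}
        (nsets V 2 - (E \<union> {{v, a} | a. a \<in> \<Union>\<A>})))"
  using \<A> new
proof (induction \<A> rule: finite_induct)
  case empty
  then show ?case by simp
next
  case (insert A \<A>)
  let ?E = "\<lambda>\<A>. E \<union> {{v, a} | a. a \<in> \<Union>\<A>}"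
  let ?c = "\<lambda>\<A>. Config (parts_of V f) (?E \<A>) {} (nsets V 2 - ?E \<A>)"
  have "(narrow_step r V W)\<^sup>*\<^sup>* (Config (parts_of V f) E {} (nsets V 2 - E)) (?c \<A>)"
    using insert.IH insert.prems by auto
  moreover have "narrow_step r V W (?c \<A>) (?c (insert A \<A>))"
    unfolding narrow_step_def
  proof
    have pb: "pairs_between {v} A \<subseteq> nsets V 2"
      using insert.prems(2) F unfolding pairs_between_def by blast
    have new_E: "?E (insert A \<A>) = ?E \<A> \<union> ((nsets V 2 - ?E \<A>) \<inter> pairs_between {v} A)"
      using pb by (auto simp: pairs_between_def)
    have new_U: "nsets V 2 - ?E (insert A \<A>) = (nsets V 2 - ?E \<A>) - pairs_between {v} A"
      by (auto simp: pairs_between_def)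
    show "construction_step (?c \<A>) (?c (insert A \<A>))"
      unfolding new_U unfolding new_E using v insert.prems(1)
      by (intro construction_step.resolve_pos) auto
    have "?E (insert A \<A>) \<union> {} \<subseteq> F" using E insert.prems(2) by auto
    with assms(1) show "narrow r V W (?c (insert A \<A>))"
      using w by (rule narrow_parts_of)
  qed
  ultimately show ?case by (rule rtranclp.rtrancl_into_rtrancl)
qed

definition stage_label :: "'a set set \<Rightarrow> 'a set \<Rightarrow> 'a \<Rightarrow> 'a + 'a set" where
  "stage_label E L x = (if x \<in> L then Inl x else Inr {w \<in> L. {x, w} \<in> E})"

definition stage :: "'a graph \<Rightarrow> 'a set \<Rightarrow> 'a config" where
  "stage G L = Config (parts_of (verts G) (stage_label (edges G) L)) (edges G \<inter> Pow (verts G - L)) {}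
     (nsets (verts G) 2 - edges G \<inter> Pow (verts G - L))"

text \<open>While the edges at \<open>v\<close> are being resolved, \<open>v\<close> has a part of its own and walks may use \<open>v\<close>. A vertex
  reached from \<open>x\<close> is \<open>v\<close> itself or is labelled by its neighbourhood in \<open>L\<close>, which is contained in \<open>v\<close>
  together with the boundary for \<open>L - {v}\<close>. Vertices of \<open>L - {v}\<close> are not on any resolved edge.\<close>

lemma card_stage_labels_le:
  assumes L: "L \<subseteq> verts G" and v: "v \<in> L"
    and sep: "\<And>x. x \<in> verts G - (L - {v}) \<Longrightarrow> separable G K (r + 1) x (L - {v})"
    and K: "1 \<le> K" and x: "x \<in> verts G"
  shows "card (stage_label (edges G) L ` reach (edges G \<inter> Pow (verts G - (L - {v}))) (verts G) r x)
           \<le> 2 ^ (K ^ (r + 1) + 1) + 1"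
proof -
  let ?E = "edges G" and ?V = "verts G" and ?L = "L - {v}"
  let ?F = "?E \<inter> Pow (?V - ?L)"
  have stay: "reach ?F ?V n x \<subseteq> reach ?E (?V - ?L) n x" for n
    by (induction n) auto
  show ?thesis
  proof (cases "x \<in> ?L")
    case True
    have "reach ?F ?V n x \<subseteq> {x}" for n
      using True by (induction n) auto
    then have "stage_label ?E L ` reach ?F ?V r x \<subseteq> {stage_label ?E L x}" by blast
    then have "card (stage_label ?E L ` reach ?F ?V r x) \<le> card {stage_label ?E L x}"
      by (intro card_mono) auto
    then show ?thesis by simp
  next
    case False
    define bd where "bd = {w \<in> ?L. \<exists>u\<in>reach ?E (?V - ?L) r x. {u, w} \<in> ?E}"
    have bd: "finite bd \<and> card bd \<le> K ^ (r + 1)"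
      unfolding bd_def by (rule card_boundary_le[OF sep _ K le_refl]) (use L x False in auto)
    have "stage_label ?E L ` reach ?F ?V r x \<subseteq> insert (Inl v) (Inr ` Pow (insert v bd))"
    proof
      fix a assume "a \<in> stage_label ?E L ` reach ?F ?V r x"
      then obtain u where u: "u \<in> reach ?E (?V - ?L) r x" "a = stage_label ?E L u"
        using stay by blast
      then have "u \<notin> ?L" using reach_subset False by fastforce
      then show "a \<in> insert (Inl v) (Inr ` Pow (insert v bd))"
        using u by (auto simp: stage_label_def bd_def)
    qed
    then have "card (stage_label ?E L ` reach ?F ?V r x) \<le>
        card (insert (Inl v :: 'a + 'a set) (Inr ` Pow (insert v bd)))"
      using bd by (intro card_mono) auto
    also have "\<dots> \<le> card ((Inr :: 'a set \<Rightarrow> 'a + 'a set) ` Pow (insert v bd)) + 1"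
      using bd by (simp add: card_insert_if)
    also have "\<dots> \<le> card (Pow (insert v bd)) + 1" using bd by (simp add: card_image_le)
    also have "\<dots> \<le> 2 ^ (K ^ (r + 1) + 1) + 1"
    proof -
      have "card (insert v bd) \<le> K ^ (r + 1) + 1" using bd by (simp add: card_insert_if)
      then have "(2::nat) ^ card (insert v bd) \<le> 2 ^ (K ^ (r + 1) + 1)" by (intro power_increasing) auto
      then show ?thesis using bd by (simp add: card_Pow)
    qed
    finally show ?thesis .
  qed
qed

lemma narrow_stage_step:
  assumes G: "fin_simple_graph G" and L: "L \<subseteq> verts G" and v: "v \<in> L"
    and sep: "\<And>x. x \<in> verts G - (L - {v}) \<Longrightarrow> separable G K (r + 1) x (L - {v})"
    and K: "1 \<le> K" and W: "W = 2 ^ (K ^ (r + 1) + 1) + 1"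
  shows "(narrow_step r (verts G) W)\<^sup>*\<^sup>* (stage G L) (stage G (L - {v}))"
proof -
  let ?E = "edges G" and ?V = "verts G"
  let ?F = "?E \<inter> Pow (?V - (L - {v}))" and ?H = "?E \<inter> Pow (?V - L)"
  let ?f = "stage_label ?E L" and ?g = "stage_label ?E (L - {v})"
  have finV: "finite ?V" and Ens: "?E \<subseteq> nsets ?V 2" using G by (auto simp: fin_simple_graph_def)
  have vV: "v \<in> ?V" using L v by blast
  have w: "\<And>x. x \<in> ?V \<Longrightarrow> card (?f ` reach ?F ?V r x) \<le> W"
    unfolding W by (rule card_stage_labels_le[OF L v sep K])
  define nbs where "nbs = {a \<in> ?V - L. {v, a} \<in> ?E}"
  define \<A> where "\<A> = (\<lambda>a. {y \<in> ?V. ?f y = ?f a}) ` nbs"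
  have f_v: "?f y = ?f v \<longleftrightarrow> y = v" for y using v by (auto simp: stage_label_def)
  \<comment> \<open>\<open>v\<close> still belongs to \<open>L\<close>, so the labels determine adjacency to \<open>v\<close>\<close>
  have same: "y \<in> nbs" if "a \<in> nbs" "y \<in> ?V" "?f y = ?f a" for a y
  proof -
    have "y \<notin> L" and eq: "{w \<in> L. {y, w} \<in> ?E} = {w \<in> L. {a, w} \<in> ?E}"
      using that by (auto simp: stage_label_def nbs_def split: if_splits)
    moreover have "{a, v} \<in> ?E" using that(1) by (simp add: nbs_def insert_commute)
    ultimately have "{y, v} \<in> ?E" using v by blast
    then show ?thesis using \<open>y \<notin> L\<close> that(2) by (simp add: nbs_def insert_commute)
  qed
  have un: "\<Union>\<A> = nbs"
  proof
    show "\<Union>\<A> \<subseteq> nbs" unfolding \<A>_def using same by blast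
    show "nbs \<subseteq> \<Union>\<A>" unfolding \<A>_def nbs_def by blast
  qed
  have pos: "?H \<union> {{v, a} | a. a \<in> \<Union>\<A>} = ?F"
  proof (rule set_eqI, rule iffI)
    fix e assume "e \<in> ?H \<union> {{v, a} | a. a \<in> \<Union>\<A>}"
    then show "e \<in> ?F" using vV by (auto simp: un nbs_def)
  next
    fix e assume e: "e \<in> ?F"
    show "e \<in> ?H \<union> {{v, a} | a. a \<in> \<Union>\<A>}"
    proof (cases "v \<in> e")
      case True
      have "card e = 2" using e Ens by (auto simp: nsets_def)
      then obtain a where "e = {v, a}" "a \<noteq> v"
        using True by (metis card_2_iff doubleton_eq_iff insertE singletonD)
      then show ?thesis using e by (auto simp: un nbs_def)
    next
      case False
      then show ?thesis using e by auto
    qed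
  qed
  have "(narrow_step r ?V W)\<^sup>*\<^sup>* (Config (parts_of ?V ?f) ?H {} (nsets ?V 2 - ?H))
     (Config (parts_of ?V ?f) (?H \<union> {{v, a} | a. a \<in> \<Union>\<A>}) {}
        (nsets ?V 2 - (?H \<union> {{v, a} | a. a \<in> \<Union>\<A>})))"
  proof (rule narrow_resolve[where F = ?F])
    show "{v} \<in> parts_of ?V ?f" using vV f_v by (auto simp: parts_of_def)
    show "finite \<A>" using finV by (auto simp: \<A>_def nbs_def)
    show "\<A> \<subseteq> parts_of ?V ?f" by (auto simp: \<A>_def nbs_def parts_of_def)
    show "?H \<subseteq> ?F" by auto
    show "{v, a} \<in> ?F" if "A \<in> \<A>" "a \<in> A" for A a
    proof -
      have "a \<in> nbs" using that un by blast
      then show ?thesis using vV by (auto simp: nbs_def)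
    qed
    show "?F \<subseteq> nsets ?V 2" using Ens by blast
  qed (use finV w in auto)
  then have "(narrow_step r ?V W)\<^sup>*\<^sup>* (stage G L) (Config (parts_of ?V ?f) ?F {} (nsets ?V 2 - ?F))"
    unfolding pos by (simp add: stage_def)
  also have "(narrow_step r ?V W)\<^sup>*\<^sup>* \<dots> (stage G (L - {v}))"
    unfolding stage_def
  proof (rule narrow_coarsening[where F = ?F])
    show "?g x = ?g y" if "?f x = ?f y" for x y
      using that unfolding stage_label_def by (auto split: if_splits)
  qed (use finV w in auto)
  finally show ?thesis .
qed

text \<open>Every vertex that has left \<open>L\<close> was separated from what remained of \<open>L\<close> at that time, hence is
  separated from every later, smaller \<open>L\<close>.\<close>

lemma narrow_stage_to_empty:
  assumes G: "fin_simple_graph G" and K: "1 \<le> K" and W: "W = 2 ^ (K ^ (r + 1) + 1) + 1"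
    and pick: "\<And>S. S \<subseteq> verts G \<Longrightarrow> S \<noteq> {} \<Longrightarrow> \<exists>v\<in>S. separable G K (r + 1) v (S - {v})"
    and L: "L \<subseteq> verts G"
    and sep: "\<And>x. x \<in> verts G - L \<Longrightarrow> separable G K (r + 1) x L"
  shows "(narrow_step r (verts G) W)\<^sup>*\<^sup>* (stage G L) (stage G {})"
proof -
  have "finite L" using G L finite_subset by (auto simp: fin_simple_graph_def)
  then show ?thesis using L sep
  proof (induction L rule: finite_psubset_induct)
    case (psubset L)
    show ?case
    proof (cases "L = {}")
      case False
      then obtain v T where v: "v \<in> L" and T: "finite T" "card T \<le> K"
        "reach (edges G) (verts G - T) (r + 1) v \<inter> (L - {v}) = {}"
        using pick[OF psubset.prems(1)] by blast
      have sep': "separable G K (r + 1) x (L - {v})"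
        if "x \<in> verts G - (L - {v})" for x
      proof (cases "x = v")
        case True
        then show ?thesis using T by blast
      next
        case False
        then show ?thesis using psubset.prems(2)[of x] that by blast
      qed
      have "(narrow_step r (verts G) W)\<^sup>*\<^sup>* (stage G L) (stage G (L - {v}))"
        using G psubset.prems(1) v sep' K W by (rule narrow_stage_step)
      also have "(narrow_step r (verts G) W)\<^sup>*\<^sup>* \<dots> (stage G {})"
        using v psubset.prems(1) sep' by (intro psubset.IH) auto
      finally show ?thesis .
    qed simp
  qed
qed

lemma merge_width_le_if_narrow:
  assumes steps: "(narrow_step r (verts G) W)\<^sup>*\<^sup>* (initial_config (verts G)) c"
    and init: "narrow r (verts G) W (initial_config (verts G))"
    and final: "card (parts c) \<le> 1" "unresolved c = {}" "pos c = edges G"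
  shows "merge_width r G \<le> enat W"
proof -
  have "\<exists>cs. cs \<noteq> [] \<and> hd cs = initial_config (verts G) \<and> last cs = c \<and>
      successively construction_step cs \<and> (\<forall>c\<in>set cs. narrow r (verts G) W c)"
    using steps
  proof (induction rule: rtranclp_induct)
    case base
    then show ?case using init by (intro exI[of _ "[initial_config (verts G)]"]) auto
  next
    case (step c c')
    then obtain cs where "cs \<noteq> []" "hd cs = initial_config (verts G)" "last cs = c"
      "successively construction_step cs" "\<forall>c\<in>set cs. narrow r (verts G) W c" by blast
    then show ?case using step(2)
      by (intro exI[of _ "cs @ [c']"]) (auto simp: successively_append_iff narrow_step_def)
  qed
  then obtain cs where cs: "cs \<noteq> []" "hd cs = initial_config (verts G)" "last cs = c"
      "successively construction_step cs" "\<forall>c\<in>set cs. narrow r (verts G) W c" by blast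
  have "construction_sequence G cs" using cs final by (simp add: construction_sequence_def)
  moreover have "sequence_width r (verts G) cs \<le> W"
    unfolding sequence_width_def using cs(5) by (intro Least_le) (simp add: narrow_def)
  ultimately show ?thesis
    unfolding merge_width_def by (intro INF_lower2[of cs]) auto
qed

lemma merge_width_bound:
  assumes G: "fin_simple_graph G" and K: "1 \<le> K" and W: "W = 2 ^ (K ^ (r + 1) + 1) + 1"
    and pick: "\<And>S. S \<subseteq> verts G \<Longrightarrow> S \<noteq> {} \<Longrightarrow> \<exists>v\<in>S. separable G K (r + 1) v (S - {v})"
  shows "merge_width r G \<le> enat W"
proof -
  let ?E = "edges G" and ?V = "verts G"
  have finV: "finite ?V" and Ens: "?E \<subseteq> nsets ?V 2" using G by (auto simp: fin_simple_graph_def)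
  have W1: "1 \<le> W" using W by simp
  have single: "{y \<in> ?V. stage_label ?E ?V y = stage_label ?E ?V x} = {x}" if "x \<in> ?V" for x
    using that by (auto simp: stage_label_def)
  have no_edge: "?E \<inter> Pow {} = {}" using Ens by (auto simp: nsets_def)
  have init: "initial_config ?V = stage G ?V"
    using single no_edge unfolding initial_config_def stage_def parts_of_def by auto
  have init_narrow: "narrow r ?V W (stage G ?V)"
    unfolding stage_def
  proof (rule narrow_parts_of[where F = "{}"])
    show "card (stage_label ?E ?V ` reach {} ?V r v) \<le> W" for v
    proof -
      have "reach {} ?V n v = {v}" for n by (induction n) auto
      then show ?thesis using W1 by simp
    qed
  qed (use finV no_edge in auto)
  have steps: "(narrow_step r ?V W)\<^sup>*\<^sup>* (stage G ?V) (stage G {})"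
    using G K W pick by (rule narrow_stage_to_empty) auto
  have empty_stage: "stage G {} = Config (parts_of ?V (\<lambda>_. Inr {} :: 'a + 'a set)) ?E {} (nsets ?V 2 - ?E)"
  proof -
    have "?E \<inter> Pow ?V = ?E" using Ens by (auto simp: nsets_def)
    then show ?thesis by (simp add: stage_def stage_label_def parts_of_def)
  qed
  show ?thesis
  proof (cases "?V = {}")
    case True
    then show ?thesis
      using steps init init_narrow Ens
      by (intro merge_width_le_if_narrow[of r G W "stage G {}"])
        (auto simp: empty_stage parts_of_def nsets_def)
  next
    case False
    let ?c = "Config {?V} ?E (nsets ?V 2 - ?E) {}"
    have one: "parts_of ?V (\<lambda>_. Inr {} :: 'a + 'a set) = {?V}"
      using False by (auto simp: parts_of_def)
    have pb: "nsets ?V 2 \<subseteq> pairs_between ?V ?V"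
      by (auto simp: nsets_def pairs_between_def card_2_iff)
    have "construction_step (Config {?V} ?E {} (nsets ?V 2 - ?E))
       (Config {?V} ?E ({} \<union> ((nsets ?V 2 - ?E) \<inter> pairs_between ?V ?V))
         (nsets ?V 2 - ?E - pairs_between ?V ?V))"
      by (rule construction_step.resolve_neg) auto
    moreover have "{} \<union> ((nsets ?V 2 - ?E) \<inter> pairs_between ?V ?V) = nsets ?V 2 - ?E"
      "nsets ?V 2 - ?E - pairs_between ?V ?V = {}" using pb by auto
    ultimately have "construction_step (stage G {}) ?c" by (simp add: empty_stage one)
    moreover have "narrow r ?V W ?c"
    proof -
      have "reachable_parts r ?V ?c v \<subseteq> {?V}" for v by (auto simp: reachable_parts_def)
      then have "card (reachable_parts r ?V ?c v) \<le> card {?V}" for v by (intro card_mono) auto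
      then show ?thesis using W1 unfolding narrow_def by (auto intro: le_trans)
    qed
    ultimately have "(narrow_step r ?V W)\<^sup>*\<^sup>* (stage G ?V) ?c"
      using steps by (meson narrow_step_def rtranclp.rtrancl_into_rtrancl)
    then show ?thesis
      using init init_narrow by (intro merge_width_le_if_narrow[of r G W ?c]) auto
  qed
qed

theorem theorem1p6:
  fixes \<C> :: "'a graph set"
  assumes "graph_class \<C>"
    and "bounded_expansion \<C>"
  shows "bounded_merge_width \<C>"
  unfolding bounded_merge_width_def
proof
  fix r
  obtain k where k: "\<And>G. G \<in> \<C> \<Longrightarrow> sparse_minors (2 * r + 1) k G"
    using bounded_expansion_sparse_minors[OF assms] by blast
  define K where "K = k * ((2 * r + 1) * k + 1) * (k + 1) + 1"
  define W where "W = (2::nat) ^ (K ^ (r + 1) + 1) + 1"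
  have "merge_width r G \<le> enat W" if "G \<in> \<C>" for G
  proof (rule merge_width_bound[OF _ _ W_def])
    show G: "fin_simple_graph G" using assms(1) that by (simp add: graph_class_def)
    show "1 \<le> K" by (simp add: K_def)
    show "\<exists>v\<in>S. separable G K (r + 1) v (S - {v})"
      if "S \<subseteq> verts G" "S \<noteq> {}" for S
      using exists_separated_vertex[OF G k[OF \<open>G \<in> \<C>\<close>] that] unfolding K_def
      by (meson le_SucI le_trans trans_le_add1 order_refl)
  qed
  then have "(SUP G\<in>\<C>. merge_width r G) \<le> enat W" by (intro SUP_least)
  then show "(SUP G\<in>\<C>. merge_width r G) < \<infinity>" by (rule order.strict_trans1) simp
qed

end
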